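(* In the setting described in the context, assume that for every $m\ge1$, every $x\in\mathcal X^{\mathbb N}$ and all $y,y'\in\mathcal Y$, $d(F_m(x;y),F_m(x;y'))\le\delta(y,y')$, and that there exist constants $t_0>0$ and $K_k\ge1$ such that $$\mathbb E\big[\exp\big(t_0\,G_{\varepsilon_k}(\varepsilon_k)\big)\big]\le K_k,\qquad k\in[1,n].$$ Let $$K=\frac{2}{e^2}\sum_{k=1}^n\Big(\frac{a_{n-k}(n-k)}{a_{n-1}(n-1)}\Big)^2K_k,\qquad \delta_n=\frac{t_0}{a_{n-1}(n-1)}.$$ Then, for either choice of sign and every $t\in[0,\delta_n)$, $$\mathbb E[e^{\pm tS_n}]\le\exp\Big(\frac{t^2K\delta_n^{-2}}{1-t\delta_n^{-1}}\Big).$$ Consequently, for every $x>0$, $$\mathbb P(\pm S_n\ge x)\le\exp\Big(\frac{-(x\delta_n)^2}{2K(1+\sqrt{1+x\delta_n/K})+x\delta_n}\Big)\le\exp\Big(\frac{-(x\delta_n)^2}{4K+2x\delta_n}\Big).$$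
   Context: Let $(\mathcal X,d)$ and $(\mathcal Y,\delta)$ be complete separable metric spaces. Let $(\varepsilon_i)_{i\ge1}$ be independent (not necessarily identically distributed) $\mathcal Y$-valued random variables, with $P_{\varepsilon_k}$ the law of $\varepsilon_k$. Let $(X_i)_{i\le0}$ be a deterministic sequence in $\mathcal X$. For each $m\ge1$ let $F_m:\mathcal X^{\mathbb N}\times\mathcal Y\to\mathcal X$ be measurable, and define recursively $X_m=F_m((X_{m-i})_{i\ge1};\varepsilon_m)$ for $m\ge1$. Assume there are nonnegative numbers $a_i$, $i\ge1$, with $\sum_{i\ge1}a_i<1$, such that for all $m\ge1$ and all sequences $(x_{m-i})_{i\ge1},(x'_{m-i})_{i\ge1}$ in $\mathcal X$, $$\mathbb E\big[d\big(F_m((x_{m-i})_{i\ge1};\varepsilon_m),F_m((x'_{m-i})_{i\ge1};\varepsilon_m)\big)\big]\le\sum_{i=1}^\infty a_i\,d(x_{m-i},x'_{m-i}).$$ Fix $n\ge1$ and let $f:\mathcal X^n\to\mathbb R$ satisfy $|f(x_1,\ldots,x_n)-f(x'_1,\ldots,x'_n)|\le\sum_{i=1}^n d(x_i,x'_i)$. Put $S_n=f(X_1,\ldots,X_n)-\mathbb E[f(X_1,\ldots,X_n)]$. The numbers $a_k(k)$, $k\ge0$, are defined recursively by $a_0(0)=1$ and $a_k(k)=1+a_k+\sum_{l=1}^{k-1}a_l(l)\,a_{k-l}$ for $k\ge1$ (so $a_1(1)=1+a_1$). $G_{\varepsilon_k}(y)=\int\delta(y,y')\,P_{\varepsilon_k}(dy')$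 for $y\in\mathcal Y$. *)

theory Defs
  imports "HOL-Probability.Probability"
begin

text \<open>The exponential on $[0,\infty]$ with $e^\infty = \infty$, so that a bound on an
  \<open>nn_integral\<close> of it includes the finiteness of the exponential moment.\<close>

definition exp_ennreal :: "ennreal \<Rightarrow> ennreal" where
  "exp_ennreal u = (if u = \<infinity> then \<infinity> else ennreal (exp (enn2real u)))"

definition mean_dist :: "'y::metric_space measure \<Rightarrow> 'y \<Rightarrow> ennreal" where
  "mean_dist P y = (\<integral>\<^sup>+ y'. ennreal (dist y y') \<partial>P)"

text \<open>\<open>diag_coeff a k\<close> is the number usually written $a_k(k)$; the value \<open>a 0\<close> is never used.\<close>

fun diag_coeff :: "(nat \<Rightarrow> real) \<Rightarrow> nat \<Rightarrow> real" where
  "diag_coeff a 0 = 1"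
| "diag_coeff a (Suc k) = 1 + a (Suc k) + (\<Sum>l = 1..k. diag_coeff a l * a (Suc k - l))"

text \<open>
  Conventions. A sequence $(x_{m-i})_{i \ge 1}$ is a function \<open>x :: nat \<Rightarrow> 'x\<close> with \<open>x j\<close> standing
  for $x_{m-1-j}$, so it is paired with the coefficient \<open>a (Suc j)\<close>.
  A function of $(x_1,\dots,x_n)$ is a function on \<open>nat \<Rightarrow> 'x\<close> that is Lipschitz with respect to the
  coordinates \<open>1..n\<close> only; such a bound forces it to ignore all other coordinates.
\<close>

end

theory Submission
  imports Defs
begin

text \<open>
  Let $g_k$ be the conditional expectation of $f(X_1,\dots,X_n)$ given $X_1,\dots,X_k$. Integrating
  out one noise variable at a time, the contraction makes $g_k$ Lipschitz with coefficient
  $a_{n-k}(n-k)$ in its last coordinate, so the martingale difference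
  $g_k - g_{k-1}$ is bounded by $a_{n-k}(n-k)\,G_{\varepsilon_k}(\varepsilon_k)$. The pointwise inequality
  $e^z \le 1 + z + \frac{2}{e^2}\frac{u^2}{1-u} e^w$ for $|z| \le u w$, $0 \le u < 1$, then bounds
  its conditional exponential moment by that of a Bernstein variable. Multiplying these
  bounds and applying Markov's inequality with $1 - t/\delta_n = (1 + x\delta_n/K)^{-1/2}$ finishes the proof.
\<close>


text \<open>The constant 2/e^2 is the supremum of \<open>w ^ j * exp (- w) / fact j\<close> over
  \<open>w \<ge> 0\<close> and \<open>j \<ge> 2\<close>, attained at \<open>w = j = 2\<close>. The
  Taylor remainder therefore costs a single \<open>exp w\<close>, which is what the moment
  hypothesis at \<open>t0\<close> controls. Conditional expectations are not taken as abstract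
  operators: \<open>cmean\<close> integrates backward over arbitrary coordinates \<open>u\<close>,
  so its Lipschitz bounds hold for every \<open>u\<close>, and conditioning becomes Fubini for the
  factorised law of the current state and the next noise variable. The two regularity conditions on
  \<open>F\<close> do different jobs. The contraction compares two pasts under the same noise and
  moves weight from one coordinate to earlier ones. The Lipschitz condition in the noise bounds the
  increments; together with the moment hypothesis it also yields the integrability of
  f(X_1,...,X_n), which is not assumed.\<close>

section \<open>Exponential inequalities and the Bernstein exponent\<close>

text \<open>The function \<open>w ^ j * exp (- w)\<close> peaks at \<open>w = j\<close>. The proof
  raises the tangent bound \<open>1 + v \<le> exp v\<close> at \<open>v = w / j - 1\<close> to the
  power \<open>j\<close>.\<close>

lemma power_div_fact_le_exp:
  fixes w :: real
  assumes "w \<ge> 0" "j \<ge> 1"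
  shows "w ^ j \<le> (real j / exp 1) ^ j * exp w"
proof -
  have "w / j \<le> exp (w / j - 1)"
    using exp_ge_add_one_self[of "w / j - 1"] by simp
  then have "(w / j) ^ j \<le> exp (w / j - 1) ^ j"
    using assms by (intro power_mono) auto
  also have "\<dots> = exp w / exp 1 ^ j"
    using assms by (simp add: exp_diff power_divide flip: exp_of_nat_mult)
  finally show ?thesis
    using assms by (simp add: power_divide field_simps)
qed

text \<open>Passing from \<open>j\<close> to \<open>j + 1\<close> multiplies the left side by
  \<open>(1 + 1 / j) ^ j / exp 1\<close>, which is at most 1, and \<open>j = 2\<close> gives
  equality.\<close>

lemma stirling_ratio_le:
  assumes "j \<ge> 2"
  shows "(real j / exp 1) ^ j / fact j \<le> 2 / (exp 1)\<^sup>2"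
  using assms
proof (induction j rule: dec_induct)
  case base
  show ?case by (simp add: power_divide fact_numeral)
next
  case (step j)
  have ratio: "real (Suc j) / exp 1 = (1 + 1 / real j) * (real j / exp 1)"
    using step by (simp add: field_simps)
  have "(1 + 1 / real j) ^ j \<le> exp (1 / real j) ^ j"
    using step by (intro power_mono) (auto simp: exp_ge_add_one_self)
  also have "\<dots> = exp 1"
    using step by (simp flip: exp_of_nat_mult)
  finally have *: "(1 + 1 / real j) ^ j \<le> exp 1" .
  have "(real (Suc j) / exp 1) ^ Suc j / fact (Suc j)
      = (real (Suc j) / exp 1) ^ j / (exp 1 * fact j)"
  proof -
    have "p * (r / e) / (r * q) = p / (e * q)" if "r \<noteq> 0" for p q r e :: real
      using that by simp
    then show ?thesis
      by (simp only: power_Suc2 fact_Suc of_nat_Suc)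
  qed
  also have "(real (Suc j) / exp 1) ^ j = (1 + 1 / real j) ^ j * (real j / exp 1) ^ j"
    using step by (simp only: ratio flip: power_mult_distrib)
  also have "(1 + 1 / real j) ^ j * (real j / exp 1) ^ j / (exp 1 * fact j)
      \<le> exp 1 * (real j / exp 1) ^ j / (exp 1 * fact j)"
    by (intro divide_right_mono mult_right_mono *) auto
  also have "\<dots> = (real j / exp 1) ^ j / fact j"
    by simp
  also have "\<dots> \<le> 2 / (exp 1)\<^sup>2"
    by (rule step.IH)
  finally show ?case .
qed

text \<open>Beyond the linear term, every \<open>w ^ j / fact j\<close> is absorbed into the same
  multiple of \<open>exp w\<close>, so only the geometric series of the \<open>u ^ j\<close>
  remains. The term \<open>z\<close> keeps its sign so that it can vanish on averaging.\<close>

lemma exp_le_quadratic_remainder: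
  fixes z u w :: real
  assumes z: "\<bar>z\<bar> \<le> u * w" and u: "0 \<le> u" "u < 1" and w: "0 \<le> w"
  shows "exp z \<le> 1 + z + 2 / (exp 1)\<^sup>2 * u\<^sup>2 / (1 - u) * exp w"
proof -
  have sm: "summable (\<lambda>j. z ^ j / fact j)"
    using summable_exp_generic[of z] by (simp add: divide_inverse mult.commute)
  have "exp z = (\<Sum>j. z ^ j / fact j)"
    by (simp add: exp_def divide_inverse mult.commute)
  also have "\<dots> = (\<Sum>j. z ^ (j + 2) / fact (j + 2)) + (\<Sum>j<2. z ^ j / fact j)"
    by (rule suminf_split_initial_segment[OF sm])
  also have "(\<Sum>j<2. z ^ j / fact j) = 1 + z"
    by (simp add: numeral_2_eq_2)
  also have "(\<Sum>j. z ^ (j + 2) / fact (j + 2))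
      \<le> (\<Sum>j. 2 / (exp 1)\<^sup>2 * exp w * u\<^sup>2 * u ^ j)"
  proof (rule suminf_le)
    fix j
    have "z ^ (j + 2) / fact (j + 2) \<le> \<bar>z\<bar> ^ (j + 2) / fact (j + 2)"
      by (intro divide_right_mono) (auto simp: power_abs[symmetric] simp del: power_Suc power_Suc2)
    also have "\<dots> \<le> (u * w) ^ (j + 2) / fact (j + 2)"
      using z by (intro divide_right_mono power_mono) auto
    also have "\<dots> = u ^ (j + 2) * (w ^ (j + 2) / fact (j + 2))"
      by (simp only: power_mult_distrib times_divide_eq_right)
    also have "\<dots> \<le> u ^ (j + 2) * ((real (j + 2) / exp 1) ^ (j + 2) * exp w / fact (j + 2))"
      using u w by (intro mult_left_mono divide_right_mono power_div_fact_le_exp) auto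
    also have "\<dots> = u ^ (j + 2) * exp w * ((real (j + 2) / exp 1) ^ (j + 2) / fact (j + 2))"
      by (simp only: times_divide_eq_right mult_ac)
    also have "\<dots> \<le> u ^ (j + 2) * exp w * (2 / (exp 1)\<^sup>2)"
      using u by (intro mult_left_mono stirling_ratio_le) auto
    also have "\<dots> = 2 / (exp 1)\<^sup>2 * exp w * u\<^sup>2 * u ^ j"
      by (simp add: power_add power2_eq_square mult_ac)
    finally show "z ^ (j + 2) / fact (j + 2) \<le> 2 / (exp 1)\<^sup>2 * exp w * u\<^sup>2 * u ^ j" .
  next
    show "summable (\<lambda>j. z ^ (j + 2) / fact (j + 2))"
      using sm by (rule summable_ignore_initial_segment)
    show "summable (\<lambda>j. 2 / (exp 1)\<^sup>2 * exp w * u\<^sup>2 * u ^ j)"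
      using u by (intro summable_mult summable_geometric) auto
  qed
  also have "\<dots> = 2 / (exp 1)\<^sup>2 * exp w * u\<^sup>2 * (1 / (1 - u))"
    using u by (subst suminf_mult) (auto simp: suminf_geometric summable_geometric)
  finally show ?thesis
    by (simp add: mult_ac)
qed

text \<open>The value \<open>s = 1 - 1 / q\<close> minimises
  \<open>s\<^sup>2 * K / (1 - s) - s * y\<close> on [0,1): stationarity reads
  \<open>K * (1 / (1 - s)\<^sup>2 - 1) = y\<close>. Writing \<open>y = K * (q\<^sup>2 - 1)\<close>,
  both sides of the first identity become \<open>K * (q - 1)\<^sup>2\<close>, and this is also the
  gap between the two denominators of the second claim.\<close>

lemma bernstein_exponent:
  fixes y K :: real
  assumes y: "y > 0" and K: "K > 0"
  defines "q \<equiv> sqrt (1 + y / K)"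
  shows "y\<^sup>2 / (2 * K * (1 + q) + y) = (1 - 1 / q) * y - (1 - 1 / q)\<^sup>2 * K / (1 / q)"
    and "y\<^sup>2 / (4 * K + 2 * y) \<le> y\<^sup>2 / (2 * K * (1 + q) + y)"
    and "0 \<le> 1 - 1 / q" "1 - 1 / q < 1"
proof -
  have q1: "q > 1" unfolding q_def using y K by simp
  have q2: "q\<^sup>2 = 1 + y / K" unfolding q_def using y K by simp
  then have yq: "y = K * (q\<^sup>2 - 1)" using K by simp
  have "y\<^sup>2 / (2 * K * (1 + q) + y) = K * (q - 1)\<^sup>2"
  proof -
    have "2 * K * (1 + q) + y = K * (q + 1)\<^sup>2" 
      unfolding yq by (simp add: power2_eq_square algebra_simps)
    moreover have "y\<^sup>2 = K * (q - 1)\<^sup>2 * (K * (q + 1)\<^sup>2)"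
      unfolding yq by (simp add: power2_eq_square algebra_simps)
    ultimately show ?thesis using K q1 by simp
  qed
  also have "K * (q - 1)\<^sup>2 = (1 - 1 / q) * y - (1 - 1 / q)\<^sup>2 * K / (1 / q)"
    unfolding yq using q1 by (simp add: power2_eq_square field_simps)
  finally show "y\<^sup>2 / (2 * K * (1 + q) + y) = (1 - 1 / q) * y - (1 - 1 / q)\<^sup>2 * K / (1 / q)" .
  have "0 \<le> K * (q - 1)\<^sup>2" using K by simp
  also have "\<dots> = (4 * K + 2 * y) - (2 * K * (1 + q) + y)"
    unfolding yq by (simp add: power2_eq_square algebra_simps)
  finally show "y\<^sup>2 / (4 * K + 2 * y) \<le> y\<^sup>2 / (2 * K * (1 + q) + y)"
    using y K q1 by (intro divide_left_mono mult_pos_pos add_pos_pos) auto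
  show "0 \<le> 1 - 1 / q" "1 - 1 / q < 1" using q1 by auto
qed

section \<open>The coefficients a_k(k)\<close>

text \<open>The term \<open>l = 0\<close>, with \<open>diag_coeff a 0 = 1\<close>, absorbs the
  separate summand \<open>a (Suc k)\<close> and leaves a pure convolution.\<close>

lemma diag_coeff_Suc_sum:
  "diag_coeff a (Suc k) = 1 + (\<Sum>l<Suc k. diag_coeff a l * a (Suc k - l))"
proof -
  have "{..<Suc k} = insert 0 {1..k}" by auto
  then show ?thesis by simp
qed

lemma diag_coeff_sum: "diag_coeff a k = 1 + (\<Sum>l<k. diag_coeff a l * a (k - l))"
  by (cases k) (auto simp: diag_coeff_Suc_sum simp del: diag_coeff.simps(2))

lemma diag_coeff_ge_1:
  fixes a :: "nat \<Rightarrow> real"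
  assumes "\<And>i. i \<ge> 1 \<Longrightarrow> 0 \<le> a i"
  shows "diag_coeff a k \<ge> 1"
proof (induction k rule: less_induct)
  case (less k)
  have "0 \<le> (\<Sum>l<k. diag_coeff a l * a (k - l))"
    using less assms by (intro sum_nonneg mult_nonneg_nonneg) (auto intro: order_trans[OF zero_le_one])
  then show ?case by (subst diag_coeff_sum) simp
qed

text \<open>After an index shift the convolution for \<open>Suc k\<close> has the same factors
  \<open>a (k - l)\<close> as the one for \<open>k\<close>, now with
  \<open>diag_coeff a (Suc l)\<close> in place of \<open>diag_coeff a l\<close>, plus a nonnegative
  term. Monotonicity is what makes \<open>n - 1\<close> the index that fixes the range of
  \<open>t\<close>.\<close>

lemma diag_coeff_mono_Suc:
  fixes a :: "nat \<Rightarrow> real"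
  assumes a: "\<And>i. i \<ge> 1 \<Longrightarrow> 0 \<le> a i"
  shows "diag_coeff a k \<le> diag_coeff a (Suc k)"
proof (induction k rule: less_induct)
  case (less k)
  have d0: "0 \<le> diag_coeff a l" for l
    by (rule order_trans[OF zero_le_one diag_coeff_ge_1[OF a]])
  have "(\<Sum>l<k. diag_coeff a l * a (k - l)) \<le> (\<Sum>l<k. diag_coeff a (Suc l) * a (k - l))"
    using less a by (intro sum_mono mult_right_mono) auto
  also have "\<dots> \<le> (\<Sum>l<Suc k. diag_coeff a l * a (Suc k - l))"
    using a d0 by (subst sum.lessThan_Suc_shift) auto
  finally show ?case
    using diag_coeff_sum[of a k] diag_coeff_sum[of a "Suc k"] by linarith
qed

lemma diag_coeff_mono:
  fixes a :: "nat \<Rightarrow> real"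
  assumes "\<And>i. i \<ge> 1 \<Longrightarrow> 0 \<le> a i"
  shows "mono (diag_coeff a)"
  using diag_coeff_mono_Suc[of a] assms by (simp add: mono_iff_le_Suc)

section \<open>Centered Lipschitz functions of one noise variable\<close>

text \<open>Finiteness of \<open>mean_dist P y\<close> at one point makes the distance to
  \<open>y\<close> integrable, hence \<open>\<phi>\<close> too; averaging the Lipschitz bound over
  the second argument gives the deviation.\<close>

lemma deviation_le_mean_dist:
  fixes P :: "'y::polish_space measure" and \<phi> :: "'y \<Rightarrow> real"
  assumes P: "prob_space P" and sets [measurable_cong]: "sets P = sets borel"
    and [measurable]: "\<phi> \<in> borel_measurable borel"
    and lip: "\<And>y y'. \<bar>\<phi> y - \<phi> y'\<bar> \<le> c * dist y y'"
    and fin: "mean_dist P y \<noteq> \<infinity>"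
  shows "integrable P \<phi>" and "\<bar>\<phi> y - (\<integral>y'. \<phi> y' \<partial>P)\<bar> \<le> c * enn2real (mean_dist P y)"
proof -
  interpret prob_space P by (rule P)
  have D: "integrable P (\<lambda>y'. dist y y')"
    using fin by (intro integrableI_bounded) (auto simp: mean_dist_def top.not_eq_extremum)
  have "integrable P (\<lambda>y'. \<bar>\<phi> y\<bar> + c * dist y y')"
    using D by auto
  then show I: "integrable P \<phi>"
  proof (rule Bochner_Integration.integrable_bound)
    show "AE y' in P. norm (\<phi> y') \<le> norm (\<bar>\<phi> y\<bar> + c * dist y y')"
    proof (rule AE_I2)
      fix y' show "norm (\<phi> y') \<le> norm (\<bar>\<phi> y\<bar> + c * dist y y')"
        using lip[of y y'] by simp
    qed
  qed measurable
  have "\<phi> y - (\<integral>y'. \<phi> y' \<partial>P) = (\<integral>y'. \<phi> y - \<phi> y' \<partial>P)"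
    using I by (simp add: prob_space)
  also have "\<bar>\<dots>\<bar> \<le> (\<integral>y'. \<bar>\<phi> y - \<phi> y'\<bar> \<partial>P)"
    by (rule integral_abs_bound)
  also have "\<dots> \<le> (\<integral>y'. c * dist y y' \<partial>P)"
    using D I lip by (intro integral_mono) auto
  also have "\<dots> = c * enn2real (mean_dist P y)"
    unfolding mean_dist_def by (simp add: integral_eq_nn_integral)
  finally show "\<bar>\<phi> y - (\<integral>y'. \<phi> y' \<partial>P)\<bar> \<le> c * enn2real (mean_dist P y)" .
qed

lemma measurable_exp_ennreal [measurable]: "exp_ennreal \<in> borel_measurable borel"
  unfolding exp_ennreal_def by measurable

lemma measurable_mean_dist [measurable]:
  fixes P :: "'y::polish_space measure"
  assumes "prob_space P" and [measurable_cong]: "sets P = sets borel"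
  shows "mean_dist P \<in> borel_measurable borel"
proof -
  interpret prob_space P by fact
  show ?thesis unfolding mean_dist_def by measurable
qed

text \<open>At \<open>g = \<infinity>\<close> the default \<open>enn2real g = 0\<close> makes the
  left side 1, so the comparison needs no finiteness hypothesis.\<close>

lemma exp_le_exp_ennreal:
  assumes "t \<ge> 0"
  shows "ennreal (exp (t * enn2real g)) \<le> exp_ennreal (ennreal t * g)"
  using assms by (cases g) (auto simp: exp_ennreal_def enn2real_mult ennreal_mult_eq_top_iff)

lemma AE_mean_dist_finite:
  fixes P :: "'y::polish_space measure"
  assumes P: "prob_space P" and [measurable_cong]: "sets P = sets borel" and t: "t > 0"
    and fin: "(\<integral>\<^sup>+y. exp_ennreal (ennreal t * mean_dist P y) \<partial>P) \<noteq> \<infinity>"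
  shows "AE y in P. mean_dist P y \<noteq> \<infinity>"
proof -
  note [measurable] = measurable_mean_dist[OF P assms(2)]
  have "AE y in P. exp_ennreal (ennreal t * mean_dist P y) \<noteq> \<infinity>"
    using fin by (intro nn_integral_PInf_AE) auto
  then show ?thesis
    using t by (auto elim!: eventually_mono simp: exp_ennreal_def ennreal_mult_eq_top_iff)
qed

lemma integrable_exp_mean_dist:
  fixes P :: "'y::polish_space measure"
  assumes P: "prob_space P" and [measurable_cong]: "sets P = sets borel" and t: "t > 0"
    and mom: "(\<integral>\<^sup>+y. exp_ennreal (ennreal t * mean_dist P y) \<partial>P) \<le> ennreal C"
    and C: "C \<ge> 0"
  shows "integrable P (\<lambda>y. exp (t * enn2real (mean_dist P y)))"
    and "(\<integral>y. exp (t * enn2real (mean_dist P y)) \<partial>P) \<le> C"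
proof -
  note [measurable] = measurable_mean_dist[OF P assms(2)]
  have le: "(\<integral>\<^sup>+y. ennreal (exp (t * enn2real (mean_dist P y))) \<partial>P) \<le> ennreal C"
    using t by (intro order_trans[OF nn_integral_mono mom] exp_le_exp_ennreal) simp
  then show "integrable P (\<lambda>y. exp (t * enn2real (mean_dist P y)))"
    by (intro integrableI_bounded) (auto intro: le_less_trans)
  show "(\<integral>y. exp (t * enn2real (mean_dist P y)) \<partial>P) \<le> C"
    using le C by (auto simp: integral_eq_nn_integral intro: enn2real_leI)
qed

text \<open>Integrating the pointwise inequality kills the linear term and leaves
  \<open>1 + B * C\<close>, at most \<open>exp (B * C)\<close>. The scaling
  \<open>u = t * c / t0\<close>, \<open>w = t0 * G\<close> is chosen so that \<open>u * w\<close> is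
  \<open>t\<close> times the deviation bound and \<open>exp w\<close> is the function whose moment
  is given.\<close>

lemma exp_moment_centered_Lipschitz:
  fixes P :: "'y::polish_space measure" and \<phi> :: "'y \<Rightarrow> real"
  assumes P: "prob_space P" and sets [measurable_cong]: "sets P = sets borel"
    and [measurable]: "\<phi> \<in> borel_measurable borel"
    and lip: "\<And>y y'. \<bar>\<phi> y - \<phi> y'\<bar> \<le> c * dist y y'"
    and t0: "t0 > 0" and C: "C \<ge> 0"
    and mom: "(\<integral>\<^sup>+y. exp_ennreal (ennreal t0 * mean_dist P y) \<partial>P) \<le> ennreal C"
    and c: "c \<ge> 0" and t: "0 \<le> t" "t * c / t0 < 1"
  shows "(\<integral>\<^sup>+y. ennreal (exp (t * (\<phi> y - (\<integral>y'. \<phi> y' \<partial>P)))) \<partial>P)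
    \<le> ennreal (exp (2 / (exp 1)\<^sup>2 * (t * c / t0)\<^sup>2 / (1 - t * c / t0) * C))"
proof -
  interpret prob_space P by (rule P)
  note [measurable] = measurable_mean_dist[OF P sets]
  define u where "u = t * c / t0"
  define B where "B = 2 / (exp 1)\<^sup>2 * u\<^sup>2 / (1 - u)"
  define \<mu> where "\<mu> = (\<integral>y'. \<phi> y' \<partial>P)"
  define w where "w y = t0 * enn2real (mean_dist P y)" for y
  have u: "0 \<le> u" "u < 1" using t c t0 by (auto simp: u_def)
  have B: "B \<ge> 0" using u by (simp add: B_def)
  have AEfin: "AE y in P. mean_dist P y \<noteq> \<infinity>"
    using mom by (intro AE_mean_dist_finite[OF P sets t0]) (auto simp: top_unique)
  \<comment> \<open>An almost sure property of a probability measure holds somewhere, and one such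
    point suffices for the integrability of \<open>\<phi>\<close>.\<close>
  obtain y0 where "mean_dist P y0 \<noteq> \<infinity>"
    using AEfin eventually_happens[OF AEfin] by (auto simp: trivial_limit_def ae_filter_eq_bot_iff emeasure_space_1)
  then have I: "integrable P \<phi>"
    by (intro deviation_le_mean_dist(1)[OF P sets _ lip]) auto
  have Iw: "integrable P (\<lambda>y. exp (w y))" and w_le: "(\<integral>y. exp (w y) \<partial>P) \<le> C"
    unfolding w_def using integrable_exp_mean_dist[OF P sets t0 mom C] by auto
  have ae: "AE y in P. exp (t * (\<phi> y - \<mu>)) \<le> 1 + t * (\<phi> y - \<mu>) + B * exp (w y)"
    using AEfin
  proof eventually_elim
    case (elim y)
    have "\<bar>\<phi> y - \<mu>\<bar> \<le> c * enn2real (mean_dist P y)"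
      unfolding \<mu>_def using elim by (intro deviation_le_mean_dist(2)[OF P sets _ lip]) auto
    then have "\<bar>t * (\<phi> y - \<mu>)\<bar> \<le> t * (c * enn2real (mean_dist P y))"
      using t by (auto simp: abs_mult intro: mult_left_mono)
    also have "\<dots> = u * w y"
      using t0 by (simp add: u_def w_def)
    finally show ?case
      unfolding B_def using u t0 by (intro exp_le_quadratic_remainder) (auto simp: w_def)
  qed
  have Ir: "integrable P (\<lambda>y. 1 + t * (\<phi> y - \<mu>) + B * exp (w y))"
    using I Iw by auto
  have "(\<integral>\<^sup>+y. ennreal (exp (t * (\<phi> y - \<mu>))) \<partial>P)
      \<le> (\<integral>\<^sup>+y. ennreal (1 + t * (\<phi> y - \<mu>) + B * exp (w y)) \<partial>P)"
    using ae by (intro nn_integral_mono_AE) (auto elim!: eventually_mono intro: ennreal_leI)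
  also have "\<dots> = ennreal (\<integral>y. 1 + t * (\<phi> y - \<mu>) + B * exp (w y) \<partial>P)"
    using ae by (intro nn_integral_eq_integral Ir) 
      (auto elim!: eventually_mono intro: order_trans[OF exp_ge_zero])
  also have "(\<integral>y. 1 + t * (\<phi> y - \<mu>) + B * exp (w y) \<partial>P) = 1 + B * (\<integral>y. exp (w y) \<partial>P)"
    using I Iw by (simp add: prob_space \<mu>_def)
  also have "\<dots> \<le> 1 + B * C"
    using B w_le by (simp add: mult_left_mono)
  also have "\<dots> \<le> exp (B * C)"
    by (rule exp_ge_add_one_self)
  finally show ?thesis
    unfolding B_def u_def \<mu>_def by (simp add: ennreal_leI)
qed

section \<open>Measurability and integration against product laws\<close>

text \<open>The finite sum of coordinate distances is continuous for the product topology, so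
  \<open>f\<close> is continuous; second countability identifies the Borel sets of the product with
  the product sigma-algebra.\<close>

lemma borel_measurable_coordinate_Lipschitz:
  fixes f :: "(nat \<Rightarrow> 'x::{metric_space, second_countable_topology}) \<Rightarrow> real"
  assumes "finite I" and lip: "\<And>x x'. \<bar>f x - f x'\<bar> \<le> (\<Sum>i\<in>I. dist (x i) (x' i))"
  shows "f \<in> borel_measurable (PiM UNIV (\<lambda>_. borel))"
proof -
  have "isCont f x" for x
  proof -
    have cont: "continuous_on UNIV (\<lambda>y::nat \<Rightarrow> 'x. \<Sum>i\<in>I. dist (y i) (x i))"
      by (intro continuous_intros continuous_on_product_coordinates)
    then have "((\<lambda>y. \<Sum>i\<in>I. dist (y i) (x i)) \<longlongrightarrow> (\<Sum>i\<in>I. dist (x i) (x i))) (at x)"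
      unfolding continuous_on_def by blast
    then have "((\<lambda>y. \<Sum>i\<in>I. dist (y i) (x i)) \<longlongrightarrow> 0) (at x)"
      by simp
    then have "((\<lambda>y. f y - f x) \<longlongrightarrow> 0) (at x)"
      by (rule Lim_null_comparison[rotated]) (simp add: lip)
    then show ?thesis
      by (simp add: isCont_def LIM_zero_iff)
  qed
  then have "f \<in> borel_measurable borel"
    by (intro borel_measurable_continuous_onI) (simp add: continuous_on_eq_continuous_at)
  then show ?thesis
    using measurable_cong_sets[OF sets_PiM_equal_borel[where 'a = nat and 'b = 'x] refl] by blast
qed

text \<open>Takes the place of conditioning on \<open>V\<close>: the factorised joint law allows
  \<open>Y\<close> to be integrated out with \<open>V\<close> frozen.\<close>

lemma (in prob_space) nn_integral_product_law:
  assumes [measurable]: "V \<in> M \<rightarrow>\<^sub>M S" "Y \<in> M \<rightarrow>\<^sub>M T"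
    and eq: "distr M S V \<Otimes>\<^sub>M distr M T Y = distr M (S \<Otimes>\<^sub>M T) (\<lambda>\<omega>. (V \<omega>, Y \<omega>))"
    and [measurable]: "h \<in> borel_measurable (S \<Otimes>\<^sub>M T)"
  shows "(\<integral>\<^sup>+\<omega>. h (V \<omega>, Y \<omega>) \<partial>M) = (\<integral>\<^sup>+\<omega>. (\<integral>\<^sup>+y. h (V \<omega>, y) \<partial>distr M T Y) \<partial>M)"
proof -
  interpret Y: prob_space "distr M T Y" by (rule prob_space_distr) measurable
  have "(\<integral>\<^sup>+\<omega>. h (V \<omega>, Y \<omega>) \<partial>M) = (\<integral>\<^sup>+z. h z \<partial>(distr M S V \<Otimes>\<^sub>M distr M T Y))"
    unfolding eq by (subst nn_integral_distr) auto
  also have "\<dots> = (\<integral>\<^sup>+v. (\<integral>\<^sup>+y. h (v, y) \<partial>distr M T Y) \<partial>distr M S V)"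
    by (rule Y.nn_integral_fst[symmetric]) simp
  also have "\<dots> = (\<integral>\<^sup>+\<omega>. (\<integral>\<^sup>+y. h (V \<omega>, y) \<partial>distr M T Y) \<partial>M)"
    by (rule nn_integral_distr) measurable
  finally show ?thesis .
qed

lemma (in prob_space) integral_product_law:
  fixes h :: "_ \<Rightarrow> real"
  assumes [measurable]: "V \<in> M \<rightarrow>\<^sub>M S" "Y \<in> M \<rightarrow>\<^sub>M T"
    and eq: "distr M S V \<Otimes>\<^sub>M distr M T Y = distr M (S \<Otimes>\<^sub>M T) (\<lambda>\<omega>. (V \<omega>, Y \<omega>))"
    and [measurable]: "h \<in> borel_measurable (S \<Otimes>\<^sub>M T)"
    and int: "integrable M (\<lambda>\<omega>. h (V \<omega>, Y \<omega>))"
  shows "(\<integral>\<omega>. h (V \<omega>, Y \<omega>) \<partial>M) = (\<integral>\<omega>. (\<integral>y. h (V \<omega>, y) \<partial>distr M T Y) \<partial>M)"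
proof -
  interpret V: prob_space "distr M S V" by (rule prob_space_distr) measurable
  interpret Y: prob_space "distr M T Y" by (rule prob_space_distr) measurable
  interpret VY: pair_sigma_finite "distr M S V" "distr M T Y" ..
  have "integrable (distr M S V \<Otimes>\<^sub>M distr M T Y) h"
    unfolding eq using int by (subst integrable_distr_eq) auto
  note VY.integral_fst'[OF this]
  moreover have "(\<integral>\<omega>. h (V \<omega>, Y \<omega>) \<partial>M) = (\<integral>z. h z \<partial>(distr M S V \<Otimes>\<^sub>M distr M T Y))"
    unfolding eq by (subst integral_distr) auto
  moreover have "(\<integral>v. (\<integral>y. h (v, y) \<partial>distr M T Y) \<partial>distr M S V)
      = (\<integral>\<omega>. (\<integral>y. h (V \<omega>, y) \<partial>distr M T Y) \<partial>M)"
    by (rule integral_distr) measurable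
  ultimately show ?thesis by simp
qed

section \<open>The recursion and its conditional means\<close>

text \<open>Slot \<open>j\<close> is time \<open>m - 1 - j\<close>, and \<open>Suc j < m\<close>
  says that this time is at least 1. Coordinate 0 of \<open>u\<close> is thus never read; time 0
  belongs to \<open>past\<close>.\<close>

definition history :: "(int \<Rightarrow> 'x) \<Rightarrow> nat \<Rightarrow> (nat \<Rightarrow> 'x) \<Rightarrow> nat \<Rightarrow> 'x" where
  "history past m u j = (if Suc j < m then u (m - Suc j) else past (int m - 1 - int j))"

lemma measurable_history [measurable]:
  "history past m \<in> PiM UNIV (\<lambda>_. borel) \<rightarrow>\<^sub>M PiM UNIV (\<lambda>_. borel)"
proof -
  have "(\<lambda>u j. history past m u j) \<in> PiM UNIV (\<lambda>_. borel) \<rightarrow>\<^sub>M PiM UNIV (\<lambda>_. borel)"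
    unfolding history_def by (intro measurable_PiM_single') (auto simp: space_PiM)
  then show ?thesis by simp
qed

text \<open>The process itself is left out, to be rebuilt from the noise as \<open>state\<close>;
  \<open>f\<close> is a parameter so that both signs can be treated by instantiation.\<close>

locale driven_recursion = prob_space M
  for M :: "'w measure" +
  fixes \<epsilon> :: "nat \<Rightarrow> 'w \<Rightarrow> 'y::polish_space"
    and past :: "int \<Rightarrow> 'x::polish_space"
    and F :: "nat \<Rightarrow> (nat \<Rightarrow> 'x) \<times> 'y \<Rightarrow> 'x"
    and a :: "nat \<Rightarrow> real"
    and n :: nat
    and f :: "(nat \<Rightarrow> 'x) \<Rightarrow> real"
    and t0 :: real
    and Kc :: "nat \<Rightarrow> real"
  assumes indep: "indep_vars (\<lambda>_. borel) \<epsilon> {1..}"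
    and F_measurable:
      "\<And>m. m \<ge> 1 \<Longrightarrow> F m \<in> (PiM UNIV (\<lambda>_. borel) \<Otimes>\<^sub>M borel) \<rightarrow>\<^sub>M borel"
    and a_nonneg: "\<And>i. i \<ge> 1 \<Longrightarrow> 0 \<le> a i"
    and contraction:
      "\<And>m x x'. m \<ge> 1 \<Longrightarrow>
         (\<integral>\<^sup>+ \<omega>. ennreal (dist (F m (x, \<epsilon> m \<omega>)) (F m (x', \<epsilon> m \<omega>))) \<partial>M)
           \<le> (\<Sum>j. ennreal (a (Suc j) * dist (x j) (x' j)))"
    and f_Lipschitz: "\<And>x x'. \<bar>f x - f x'\<bar> \<le> (\<Sum>i = 1..n. dist (x i) (x' i))"
    and F_Lipschitz:
      "\<And>m x y y'. m \<ge> 1 \<Longrightarrow> dist (F m (x, y)) (F m (x, y')) \<le> dist y y'"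
    and t0: "t0 > 0"
    and Kc: "\<And>k. k \<in> {1..n} \<Longrightarrow> Kc k \<ge> 1"
    and exp_moment:
      "\<And>k. k \<in> {1..n} \<Longrightarrow>
         (\<integral>\<^sup>+ \<omega>. exp_ennreal (ennreal t0 * mean_dist (distr M borel (\<epsilon> k)) (\<epsilon> k \<omega>)) \<partial>M)
           \<le> ennreal (Kc k)"
begin

abbreviation N :: "(nat \<Rightarrow> 'x) measure" where
  "N \<equiv> PiM UNIV (\<lambda>_. borel)"

definition law :: "nat \<Rightarrow> 'y measure" where
  "law k = distr M borel (\<epsilon> k)"

definition step :: "nat \<Rightarrow> (nat \<Rightarrow> 'x) \<Rightarrow> 'y \<Rightarrow> nat \<Rightarrow> 'x" where
  "step m u y = u(m := F m (history past m u, y))"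

text \<open>\<open>cmean r u\<close> is the conditional expectation of $f(X_1,\dots,X_n)$ given that
  $X_i = $ \<open>u i\<close> for $1 \le i \le n - r$.\<close>

primrec cmean :: "nat \<Rightarrow> (nat \<Rightarrow> 'x) \<Rightarrow> real" where
  "cmean 0 u = f u"
| "cmean (Suc r) u = (\<integral>y. cmean r (step (n - r) u y) \<partial>law (n - r))"

text \<open>The weight of coordinate \<open>i\<close> once the last \<open>r\<close> variables are
  integrated out. Eliminating coordinate \<open>n - s\<close>, whose weight is by then
  \<open>diag_coeff a s\<close>, passes \<open>diag_coeff a s * a (n - s - i)\<close> on to
  coordinate \<open>i\<close>.\<close>

definition lip_coeff :: "nat \<Rightarrow> nat \<Rightarrow> real" where
  "lip_coeff r i = 1 + (\<Sum>s<r. diag_coeff a s * a (n - s - i))"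

text \<open>The initial value is a placeholder: coordinate \<open>i \<ge> 1\<close> is written at
  step \<open>i\<close> before any step reads it.\<close>

primrec state :: "nat \<Rightarrow> (nat \<Rightarrow> 'y) \<Rightarrow> nat \<Rightarrow> 'x" where
  "state 0 e = (\<lambda>_. past 0)"
| "state (Suc k) e = step (Suc k) (state k e) (e (Suc k))"

lemma measurable_noise [measurable]: "k \<ge> 1 \<Longrightarrow> \<epsilon> k \<in> M \<rightarrow>\<^sub>M borel"
  using indep by (auto simp: indep_vars_def2)

lemma prob_space_law: "k \<ge> 1 \<Longrightarrow> prob_space (law k)"
  unfolding law_def by (intro prob_space_distr) measurable

lemma sets_law [measurable_cong, simp]: "sets (law k) = sets borel"
  by (simp add: law_def)

lemma space_law [simp]: "space (law k) = UNIV"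
  by (simp add: law_def)

lemma diag_coeff_nonneg: "0 \<le> diag_coeff a k"
  by (rule order_trans[OF zero_le_one diag_coeff_ge_1]) (rule a_nonneg)

lemma lip_coeff_diag: "r < n \<Longrightarrow> lip_coeff r (n - r) = diag_coeff a r"
  unfolding lip_coeff_def by (subst diag_coeff_sum) (auto intro!: sum.cong)

lemma moment_law:
  assumes "k \<in> {1..n}"
  shows "(\<integral>\<^sup>+y. exp_ennreal (ennreal t0 * mean_dist (law k) y) \<partial>law k) \<le> ennreal (Kc k)"
proof -
  have [measurable]: "mean_dist (law k) \<in> borel_measurable borel" "\<epsilon> k \<in> M \<rightarrow>\<^sub>M borel"
    using assms by (auto intro!: measurable_mean_dist prob_space_law)
  have "(\<integral>\<^sup>+y. exp_ennreal (ennreal t0 * mean_dist (law k) y) \<partial>law k)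
      = (\<integral>\<^sup>+\<omega>. exp_ennreal (ennreal t0 * mean_dist (law k) (\<epsilon> k \<omega>)) \<partial>M)"
    by (subst law_def) (simp add: nn_integral_distr)
  then show ?thesis
    using exp_moment[OF assms] by (simp add: law_def)
qed

lemma AE_law_mean_dist: "k \<in> {1..n} \<Longrightarrow> AE y in law k. mean_dist (law k) y \<noteq> \<infinity>"
  using moment_law[of k] t0
  by (intro AE_mean_dist_finite[OF prob_space_law]) (auto simp: top_unique)

lemma ex_law_mean_dist:
  assumes "k \<in> {1..n}"
  shows "\<exists>y. mean_dist (law k) y \<noteq> \<infinity>"
proof -
  interpret L: prob_space "law k" using assms by (intro prob_space_law) auto
  show ?thesis
    using AE_law_mean_dist[OF assms] eventually_happens[OF AE_law_mean_dist[OF assms]]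
    by (auto simp: trivial_limit_def ae_filter_eq_bot_iff L.emeasure_space_1)
qed

lemma measurable_step [measurable (raw)]:
  assumes "m \<ge> 1" and [measurable]: "g \<in> L \<rightarrow>\<^sub>M N" "h \<in> L \<rightarrow>\<^sub>M borel"
  shows "(\<lambda>x. step m (g x) (h x)) \<in> L \<rightarrow>\<^sub>M N"
proof -
  note [measurable] = F_measurable[OF assms(1)]
  have "(\<lambda>x i. step m (g x) (h x) i) \<in> L \<rightarrow>\<^sub>M N"
    unfolding step_def fun_upd_def by (intro measurable_PiM_single') (auto simp: space_PiM)
  then show ?thesis by simp
qed

text \<open>Both histories share \<open>past\<close>, so they agree at all times up to 0 and the
  series of the contraction is a finite sum.\<close>

lemma contraction_law:
  assumes "m \<ge> 1"
  shows "(\<integral>\<^sup>+y. ennreal (dist (F m (history past m u, y)) (F m (history past m v, y))) \<partial>law m)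
    \<le> ennreal (\<Sum>i=1..m-1. a (m - i) * dist (u i) (v i))"
proof -
  note [measurable] = F_measurable[OF assms] measurable_noise[OF assms]
  have [measurable]: "(\<lambda>y. F m (x, y)) \<in> borel \<rightarrow>\<^sub>M borel" for x
    by (rule measurable_compose[OF _ F_measurable[OF assms]]) (auto simp: space_PiM)
  let ?g = "\<lambda>j. a (Suc j) * dist (history past m u j) (history past m v j)"
  have z: "?g j = 0" if "j \<notin> {..<m-1}" for j
    using that by (auto simp: history_def)
  have "(\<integral>\<^sup>+y. ennreal (dist (F m (history past m u, y)) (F m (history past m v, y))) \<partial>law m)
      = (\<integral>\<^sup>+\<omega>. ennreal (dist (F m (history past m u, \<epsilon> m \<omega>)) (F m (history past m v, \<epsilon> m \<omega>))) \<partial>M)"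
    unfolding law_def by (subst nn_integral_distr) auto
  also have "\<dots> \<le> (\<Sum>j. ennreal (?g j))"
    by (rule contraction[OF assms])
  also have "\<dots> = (\<Sum>j<m-1. ennreal (?g j))"
    by (rule suminf_finite) (simp_all only: z ennreal_0 finite_lessThan not_False_eq_True)
  also have "\<dots> = ennreal (\<Sum>j<m-1. ?g j)"
    by (rule sum_ennreal) (auto simp: a_nonneg)
  \<comment> \<open>Slot \<open>j\<close> is time \<open>i = m - Suc j\<close>, so
    \<open>Suc j = m - i\<close>.\<close>
  also have "(\<Sum>j<m-1. ?g j) = (\<Sum>i=1..m-1. a (m - i) * dist (u i) (v i))"
    by (rule sum.reindex_bij_witness[of _ "\<lambda>i. m - Suc i" "\<lambda>j. m - Suc j"])
      (auto simp: history_def)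
  finally show ?thesis .
qed

lemma step_noise_Lipschitz:
  assumes g: "\<And>u v. \<bar>g u - g v\<bar> \<le> (\<Sum>i=1..m. c i * dist (u i) (v i))" and m: "m \<ge> 1" and c: "c m \<ge> 0"
  shows "\<bar>g (step m u y) - g (step m u y')\<bar> \<le> c m * dist y y'"
proof -
  have "\<bar>g (step m u y) - g (step m u y')\<bar>
      \<le> (\<Sum>i=1..m. c i * dist (step m u y i) (step m u y' i))"
    by (rule g)
  also have "\<dots> = (\<Sum>i\<in>{m}. c i * dist (step m u y i) (step m u y' i))"
    using m by (intro sum.mono_neutral_right) (auto simp: step_def)
  also have "\<dots> \<le> c m * dist y y'"
    using F_Lipschitz[OF m] c by (auto simp: step_def intro: mult_left_mono)
  finally show ?thesis .
qed

text \<open>One backward induction carries both claims, since the next integral needs both. Feeding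
  the same noise \<open>y\<close> to both arguments makes their coordinates \<open>m\<close> differ
  by \<open>D y\<close>, whose mean the contraction bounds by earlier distances.\<close>

lemma cmean_Lipschitz_measurable:
  assumes "r \<le> n"
  shows "cmean r \<in> borel_measurable N \<and>
    (\<forall>u v. \<bar>cmean r u - cmean r v\<bar> \<le> (\<Sum>i=1..n-r. lip_coeff r i * dist (u i) (v i)))"
  using assms
proof (induction r)
  case 0
  have "cmean 0 = f" by auto
  then show ?case
    using f_Lipschitz borel_measurable_coordinate_Lipschitz[OF _ f_Lipschitz]
    by (auto simp: lip_coeff_def)
next
  case (Suc r)
  define m where "m = n - r"
  have m: "m \<ge> 1" "m \<in> {1..n}" and nm: "n - Suc r = m - 1" using Suc.prems by (auto simp: m_def)
  interpret L: prob_space "law m" using m by (intro prob_space_law) auto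
  note [measurable] = F_measurable[OF m(1)]
  have [measurable]: "cmean r \<in> borel_measurable N" using Suc by simp
  have lip: "\<bar>cmean r u - cmean r v\<bar> \<le> (\<Sum>i=1..m. lip_coeff r i * dist (u i) (v i))" for u v
    using Suc by (simp add: m_def)
  have cm: "lip_coeff r m = diag_coeff a r" using Suc.prems lip_coeff_diag by (simp add: m_def)
  have cmean_Suc: "cmean (Suc r) = (\<lambda>u. \<integral>y. cmean r (step m u y) \<partial>law m)"
    by (auto simp: m_def)
  have "cmean (Suc r) \<in> borel_measurable N"
    unfolding cmean_Suc using m by measurable
  moreover have "\<bar>cmean (Suc r) u - cmean (Suc r) v\<bar> \<le> (\<Sum>i=1..m-1. lip_coeff (Suc r) i * dist (u i) (v i))" for u v
  proof -
    obtain y0 where y0: "mean_dist (law m) y0 \<noteq> \<infinity>" using ex_law_mean_dist[OF m(2)] ..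
    \<comment> \<open>The contraction controls only differences; integrability for a fixed past
      comes from the Lipschitz condition in the noise.\<close>
    have I: "integrable (law m) (\<lambda>y. cmean r (step m w y))" for w
    proof (rule deviation_le_mean_dist(1)[OF L.prob_space_axioms sets_law _ _ y0])
      show "(\<lambda>y. cmean r (step m w y)) \<in> borel_measurable borel"
        using m by measurable (auto simp: space_PiM)
      show "\<bar>cmean r (step m w y) - cmean r (step m w y')\<bar> \<le> lip_coeff r m * dist y y'" for y y'
        by (rule step_noise_Lipschitz[OF lip m(1)]) (simp add: cm diag_coeff_nonneg)
    qed
    define D where "D y = dist (F m (history past m u, y)) (F m (history past m v, y))" for y
    define B where "B = (\<Sum>i=1..m-1. a (m - i) * dist (u i) (v i))"
    have B0: "B \<ge> 0" unfolding B_def using a_nonneg by (intro sum_nonneg) auto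
    have D0: "D y \<ge> 0" for y by (simp add: D_def)
    have [measurable]: "D \<in> borel_measurable borel"
      unfolding D_def using m by measurable (auto simp: space_PiM)
    have DB: "(\<integral>\<^sup>+y. ennreal (D y) \<partial>law m) \<le> ennreal B"
      unfolding D_def B_def by (rule contraction_law[OF m(1)])
    have ID: "integrable (law m) D"
      using DB D0 by (intro integrableI_bounded) (auto intro: le_less_trans)
    have ED: "(\<integral>y. D y \<partial>law m) \<le> B"
      using DB D0 B0 by (auto simp: integral_eq_nn_integral intro: enn2real_leI)
    have split: "{1..m} = insert m {1..m-1}" using m by auto
    have pw: "\<bar>cmean r (step m u y) - cmean r (step m v y)\<bar>
        \<le> (\<Sum>i=1..m-1. lip_coeff r i * dist (u i) (v i)) + diag_coeff a r * D y" for y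
    proof -
      have "\<bar>cmean r (step m u y) - cmean r (step m v y)\<bar>
         \<le> (\<Sum>i=1..m. lip_coeff r i * dist (step m u y i) (step m v y i))"
        by (rule lip)
      also have "\<dots> = (\<Sum>i=1..m-1. lip_coeff r i * dist (step m u y i) (step m v y i)) + diag_coeff a r * D y"
        unfolding split using m by (subst sum.insert) (auto simp: step_def D_def cm)
      also have "(\<Sum>i=1..m-1. lip_coeff r i * dist (step m u y i) (step m v y i))
          = (\<Sum>i=1..m-1. lip_coeff r i * dist (u i) (v i))"
        using m by (intro sum.cong) (auto simp: step_def)
      finally show ?thesis .
    qed
    have "\<bar>cmean (Suc r) u - cmean (Suc r) v\<bar> = \<bar>\<integral>y. cmean r (step m u y) - cmean r (step m v y) \<partial>law m\<bar>"
      unfolding cmean_Suc using I by simp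
    also have "\<dots> \<le> (\<integral>y. \<bar>cmean r (step m u y) - cmean r (step m v y)\<bar> \<partial>law m)"
      by (rule integral_abs_bound)
    also have "\<dots> \<le> (\<integral>y. (\<Sum>i=1..m-1. lip_coeff r i * dist (u i) (v i)) + diag_coeff a r * D y \<partial>law m)"
      using I ID pw by (intro integral_mono) auto
    also have "\<dots> = (\<Sum>i=1..m-1. lip_coeff r i * dist (u i) (v i)) + diag_coeff a r * (\<integral>y. D y \<partial>law m)"
      using ID L.prob_space by simp
    also have "\<dots> \<le> (\<Sum>i=1..m-1. lip_coeff r i * dist (u i) (v i)) + diag_coeff a r * B"
      using ED diag_coeff_nonneg by (intro add_left_mono mult_left_mono) auto
    \<comment> \<open>Here \<open>a (m - i)\<close> is \<open>a (n - r - i)\<close>, so the new term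
      is exactly the summand \<open>s = r\<close> of \<open>lip_coeff (Suc r) i\<close>.\<close>
    also have "\<dots> = (\<Sum>i=1..m-1. lip_coeff (Suc r) i * dist (u i) (v i))"
      unfolding B_def lip_coeff_def sum_distrib_left sum.distrib[symmetric]
      by (intro sum.cong) (auto simp: algebra_simps m_def)
    finally show ?thesis .
  qed
  ultimately show ?case unfolding nm by blast
qed

lemma measurable_cmean: "r \<le> n \<Longrightarrow> cmean r \<in> borel_measurable N"
  using cmean_Lipschitz_measurable by blast

lemma cmean_step_Lipschitz:
  assumes "k < n"
  shows "\<bar>cmean (n - Suc k) (step (Suc k) u y) - cmean (n - Suc k) (step (Suc k) u y')\<bar>
    \<le> diag_coeff a (n - Suc k) * dist y y'"
proof -
  have eq: "n - (n - Suc k) = Suc k" using assms by simp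
  have "lip_coeff (n - Suc k) (Suc k) = diag_coeff a (n - Suc k)"
    using lip_coeff_diag[of "n - Suc k"] assms by (simp add: eq)
  moreover have "\<bar>cmean (n - Suc k) u - cmean (n - Suc k) v\<bar>
     \<le> (\<Sum>i=1..Suc k. lip_coeff (n - Suc k) i * dist (u i) (v i))" for u v
    using cmean_Lipschitz_measurable[of "n - Suc k"] assms by (simp add: eq)
  ultimately show ?thesis
    using step_noise_Lipschitz[of "cmean (n - Suc k)" "lip_coeff (n - Suc k)" "Suc k" u y y']
      diag_coeff_nonneg by simp
qed

lemma cmean_eq:
  assumes "k < n"
  shows "cmean (n - k) u = (\<integral>y. cmean (n - Suc k) (step (Suc k) u y) \<partial>law (Suc k))"
proof -
  have "n - k = Suc (n - Suc k)" "n - (n - Suc k) = Suc k" using assms by auto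
  then show ?thesis by simp
qed

section \<open>The path as a function of the noise, and its martingale\<close>

lemma state_cong: "(\<And>i. i \<in> {1..k} \<Longrightarrow> e i = e' i) \<Longrightarrow> state k e = state k e'"
  by (induction k) auto

lemma measurable_state: "{1..k} \<subseteq> J \<Longrightarrow> state k \<in> PiM J (\<lambda>_. borel) \<rightarrow>\<^sub>M N"
proof (induction k)
  case 0
  then show ?case by (simp add: space_PiM)
next
  case (Suc k)
  have "{1..k} \<subseteq> J" and [measurable]: "Suc k \<in> J"
    using Suc.prems by auto
  note [measurable] = Suc.IH[OF this(1)]
  have "(\<lambda>e. step (Suc k) (state k e) (e (Suc k))) \<in> PiM J (\<lambda>_. borel) \<rightarrow>\<^sub>M N"
    by (rule measurable_step) auto
  then show ?case by simp
qed

lemma measurable_state_noise [measurable]: "(\<lambda>\<omega>. state k (\<lambda>i. \<epsilon> i \<omega>)) \<in> M \<rightarrow>\<^sub>M N"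
proof -
  have "(\<lambda>\<omega>. restrict (\<lambda>i. \<epsilon> i \<omega>) {1..k}) \<in> M \<rightarrow>\<^sub>M PiM {1..k} (\<lambda>_. borel)"
    by measurable
  from measurable_compose[OF this measurable_state[OF order_refl]]
  have "(\<lambda>\<omega>. state k (restrict (\<lambda>i. \<epsilon> i \<omega>) {1..k})) \<in> M \<rightarrow>\<^sub>M N" .
  moreover have "state k (restrict (\<lambda>i. \<epsilon> i \<omega>) {1..k}) = state k (\<lambda>i. \<epsilon> i \<omega>)" for \<omega>
    by (rule state_cong) auto
  ultimately show ?thesis by simp
qed

text \<open>The variables in \<open>indep_var\<close> must have the same type, so independence of the state and the
  next noise variable is expressed as the factorisation of their joint law.\<close>

lemma law_state_noise:
  "distr M N (\<lambda>\<omega>. state k (\<lambda>i. \<epsilon> i \<omega>)) \<Otimes>\<^sub>M distr M borel (\<epsilon> (Suc k))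
    = distr M (N \<Otimes>\<^sub>M borel) (\<lambda>\<omega>. (state k (\<lambda>i. \<epsilon> i \<omega>), \<epsilon> (Suc k) \<omega>))"
proof -
  let ?A = "PiM {1..k} (\<lambda>_. borel) :: (nat \<Rightarrow> 'y) measure"
  let ?B = "PiM {Suc k} (\<lambda>_. borel) :: (nat \<Rightarrow> 'y) measure"
  let ?V = "\<lambda>\<omega>. restrict (\<lambda>i. \<epsilon> i \<omega>) {1..k}"
  let ?Y = "\<lambda>\<omega>. restrict (\<lambda>i. \<epsilon> i \<omega>) {Suc k}"
  \<comment> \<open>Restricted to the blocks \<open>{1..k}\<close> and \<open>{Suc k}\<close>, both
    variables are functions on \<open>nat\<close>, so the types agree; \<open>state k\<close> and
    evaluation at \<open>Suc k\<close> then transport the factorisation.\<close>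
  have "indep_var ?A ?V ?B ?Y"
    using indep by (rule indep_var_restrict) auto
  then have [measurable]: "?V \<in> M \<rightarrow>\<^sub>M ?A" "?Y \<in> M \<rightarrow>\<^sub>M ?B"
    and eq: "distr M ?A ?V \<Otimes>\<^sub>M distr M ?B ?Y = distr M (?A \<Otimes>\<^sub>M ?B) (\<lambda>\<omega>. (?V \<omega>, ?Y \<omega>))"
    by (auto simp: indep_var_distribution_eq)
  have mst [measurable]: "state k \<in> ?A \<rightarrow>\<^sub>M N" and mev [measurable]: "(\<lambda>e. e (Suc k)) \<in> ?B \<rightarrow>\<^sub>M borel"
    by (auto intro: measurable_state)
  have map: "(\<lambda>(x, y). (state k x, y (Suc k))) \<in> ?A \<Otimes>\<^sub>M ?B \<rightarrow>\<^sub>M N \<Otimes>\<^sub>M borel"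
    unfolding split_beta
    by (rule measurable_Pair[OF measurable_compose[OF measurable_fst mst]
          measurable_compose[OF measurable_snd mev]])
  have V: "state k (?V \<omega>) = state k (\<lambda>i. \<epsilon> i \<omega>)" for \<omega>
    by (rule state_cong) auto
  have "prob_space (distr (distr M ?B ?Y) borel (\<lambda>e. e (Suc k)))"
    by (intro prob_space.prob_space_distr prob_space_distr) measurable
  then have "distr (distr M ?A ?V) N (state k) \<Otimes>\<^sub>M distr (distr M ?B ?Y) borel (\<lambda>e. e (Suc k))
      = distr (distr M ?A ?V \<Otimes>\<^sub>M distr M ?B ?Y) (N \<Otimes>\<^sub>M borel) (\<lambda>(x, y). (state k x, y (Suc k)))"
    by (intro pair_measure_distr prob_space_imp_sigma_finite) (use mst mev in simp_all)
  also have "\<dots> = distr M (N \<Otimes>\<^sub>M borel) (\<lambda>\<omega>. (state k (?V \<omega>), ?Y \<omega> (Suc k)))"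
    unfolding eq by (subst distr_distr[OF map]) (measurable, simp add: comp_def)
  also have "distr (distr M ?A ?V) N (state k) = distr M N (\<lambda>\<omega>. state k (?V \<omega>))"
    by (subst distr_distr[OF mst]) (measurable, simp add: comp_def)
  also have "distr (distr M ?B ?Y) borel (\<lambda>e. e (Suc k)) = distr M borel (\<lambda>\<omega>. ?Y \<omega> (Suc k))"
    by (subst distr_distr[OF mev]) (measurable, simp add: comp_def)
  finally show ?thesis
    unfolding V by simp
qed

lemma measurable_cmean_step:
  assumes "k < n"
  shows "(\<lambda>(u, y). cmean (n - Suc k) (step (Suc k) u y)) \<in> borel_measurable (N \<Otimes>\<^sub>M borel)"
proof -
  have [measurable]: "cmean (n - Suc k) \<in> borel_measurable N"
    using assms by (intro measurable_cmean) auto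
  show ?thesis unfolding split_beta by measurable
qed

lemma measurable_cmean_step_section:
  assumes "k < n"
  shows "(\<lambda>y. cmean (n - Suc k) (step (Suc k) u y)) \<in> borel_measurable borel"
  using measurable_Pair2[OF measurable_cmean_step[OF assms], of u] by (simp add: space_PiM)

text \<open>The bound \<open>g \<le> exp (t0 * g) / t0\<close> turns the exponential moment into a
  first moment.\<close>

lemma integrable_mean_dist_noise:
  assumes k: "k \<in> {1..n}"
  shows "integrable M (\<lambda>\<omega>. enn2real (mean_dist (law k) (\<epsilon> k \<omega>)))"
proof -
  have k1: "k \<ge> 1" using k by simp
  note [measurable] = measurable_noise[OF k1] measurable_mean_dist[OF prob_space_law[OF k1] sets_law]
  have "integrable (law k) (\<lambda>y. exp (t0 * enn2real (mean_dist (law k) y)))"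
    using Kc[OF k] by (intro integrable_exp_mean_dist(1)[OF prob_space_law[OF k1] sets_law t0 moment_law[OF k]]) auto
  then have "integrable (law k) (\<lambda>y. exp (t0 * enn2real (mean_dist (law k) y)) / t0)"
    by simp
  then have "integrable (law k) (\<lambda>y. enn2real (mean_dist (law k) y))"
  proof (rule Bochner_Integration.integrable_bound)
    have "g \<le> exp (t0 * g) / t0" for g
      using order_trans[OF _ exp_ge_add_one_self[of "t0 * g"], of "t0 * g"] t0
      by (simp add: pos_le_divide_eq mult.commute)
    then show "AE y in law k. norm (enn2real (mean_dist (law k) y))
        \<le> norm (exp (t0 * enn2real (mean_dist (law k) y)) / t0)"
      using t0 by simp
  qed measurable
  then show ?thesis
    unfolding law_def by (subst (asm) integrable_distr_eq) (auto simp flip: law_def)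
qed

text \<open>Along the path, \<open>cmean (n - k)\<close> is a martingale started at a constant.
  Integrability is carried forward in time, each increment being dominated by an integrable function
  of the new noise; \<open>k = n\<close> gives the mean of \<open>f\<close>.\<close>

lemma cmean_state_integrable_mean:
  assumes "k \<le> n"
  shows "integrable M (\<lambda>\<omega>. cmean (n - k) (state k (\<lambda>i. \<epsilon> i \<omega>))) \<and>
    (\<integral>\<omega>. cmean (n - k) (state k (\<lambda>i. \<epsilon> i \<omega>)) \<partial>M) = cmean n (\<lambda>_. past 0)"
  using assms
proof (induction k)
  case 0
  then show ?case by (simp add: prob_space)
next
  case (Suc k)
  then have k: "k < n" "Suc k \<in> {1..n}" by auto
  define V where "V = (\<lambda>\<omega>. state k (\<lambda>i. \<epsilon> i \<omega>))"
  define \<phi> where "\<phi> = (\<lambda>(u, y). cmean (n - Suc k) (step (Suc k) u y))"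
  define G where "G \<omega> = enn2real (mean_dist (law (Suc k)) (\<epsilon> (Suc k) \<omega>))" for \<omega>
  have joint: "distr M N V \<Otimes>\<^sub>M distr M borel (\<epsilon> (Suc k))
      = distr M (N \<Otimes>\<^sub>M borel) (\<lambda>\<omega>. (V \<omega>, \<epsilon> (Suc k) \<omega>))"
    unfolding V_def by (rule law_state_noise)
  have V_meas [measurable]: "V \<in> M \<rightarrow>\<^sub>M N" and \<epsilon>_meas [measurable]: "\<epsilon> (Suc k) \<in> M \<rightarrow>\<^sub>M borel"
    unfolding V_def by (rule measurable_state_noise) (rule measurable_noise, simp)
  have \<phi>_meas: "\<phi> \<in> borel_measurable (N \<Otimes>\<^sub>M borel)"
    unfolding \<phi>_def by (rule measurable_cmean_step[OF k(1)])
  have eq: "cmean (n - Suc k) (state (Suc k) (\<lambda>i. \<epsilon> i \<omega>)) = \<phi> (V \<omega>, \<epsilon> (Suc k) \<omega>)" for \<omega>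
    by (simp add: \<phi>_def V_def)
  have cmean_V: "cmean (n - k) (V \<omega>) = (\<integral>y. \<phi> (V \<omega>, y) \<partial>law (Suc k))" for \<omega>
    unfolding \<phi>_def by (simp add: cmean_eq[OF k(1)])
  have IV: "integrable M (\<lambda>\<omega>. cmean (n - k) (V \<omega>))"
    and EV: "(\<integral>\<omega>. cmean (n - k) (V \<omega>) \<partial>M) = cmean n (\<lambda>_. past 0)"
    using Suc.IH k(1) unfolding V_def by auto
  have "AE \<omega> in M. mean_dist (law (Suc k)) (\<epsilon> (Suc k) \<omega>) \<noteq> \<infinity>"
    using AE_law_mean_dist[OF k(2)] AE_distrD[of "\<epsilon> (Suc k)" M borel] unfolding law_def by simp
  then have "AE \<omega> in M. norm (\<phi> (V \<omega>, \<epsilon> (Suc k) \<omega>))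
      \<le> norm (\<bar>cmean (n - k) (V \<omega>)\<bar> + diag_coeff a (n - Suc k) * G \<omega>)"
  proof (rule eventually_mono)
    fix \<omega> assume *: "mean_dist (law (Suc k)) (\<epsilon> (Suc k) \<omega>) \<noteq> \<infinity>"
    have "\<bar>\<phi> (V \<omega>, \<epsilon> (Suc k) \<omega>) - cmean (n - k) (V \<omega>)\<bar> \<le> diag_coeff a (n - Suc k) * G \<omega>"
      unfolding cmean_V G_def
      by (rule deviation_le_mean_dist(2)[OF prob_space_law sets_law _ _ *])
        (auto simp: \<phi>_def measurable_cmean_step_section[OF k(1)] cmean_step_Lipschitz[OF k(1)])
    then show "norm (\<phi> (V \<omega>, \<epsilon> (Suc k) \<omega>))
      \<le> norm (\<bar>cmean (n - k) (V \<omega>)\<bar> + diag_coeff a (n - Suc k) * G \<omega>)"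
      by simp
  qed
  moreover have "integrable M (\<lambda>\<omega>. \<bar>cmean (n - k) (V \<omega>)\<bar> + diag_coeff a (n - Suc k) * G \<omega>)"
    using IV integrable_mean_dist_noise[OF k(2)] unfolding G_def by auto
  moreover have meas: "(\<lambda>\<omega>. \<phi> (V \<omega>, \<epsilon> (Suc k) \<omega>)) \<in> borel_measurable M"
    by (rule measurable_compose[OF measurable_Pair[OF V_meas \<epsilon>_meas] \<phi>_meas])
  ultimately have I: "integrable M (\<lambda>\<omega>. \<phi> (V \<omega>, \<epsilon> (Suc k) \<omega>))"
    by (blast intro: Bochner_Integration.integrable_bound)
  have "(\<integral>\<omega>. \<phi> (V \<omega>, \<epsilon> (Suc k) \<omega>) \<partial>M) = (\<integral>\<omega>. cmean (n - k) (V \<omega>) \<partial>M)"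
    unfolding cmean_V law_def by (rule integral_product_law[OF V_meas \<epsilon>_meas joint \<phi>_meas I])
  also note EV
  finally show ?case
    unfolding eq using I by blast
qed

lemma f_cong:
  assumes "\<And>i. i \<in> {1..n} \<Longrightarrow> x i = x' i"
  shows "f x = f x'"
  using f_Lipschitz[of x x'] assms by simp

lemma state_eq_recursion:
  assumes X_past: "\<And>i. i \<le> 0 \<Longrightarrow> X i = past i"
    and X_rec: "\<And>m. m \<ge> 1 \<Longrightarrow> X (int m) = F m (\<lambda>j. X (int m - 1 - int j), e m)"
    and i: "i \<in> {1..k}"
  shows "state k e i = X (int i)"
  using i
proof (induction k arbitrary: i)
  case 0
  then show ?case by simp
next
  case (Suc k)
  show ?case
  proof (cases "i = Suc k")
    case True
    have "history past (Suc k) (state k e) = (\<lambda>j. X (int (Suc k) - 1 - int j))"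
    proof
      fix j
      show "history past (Suc k) (state k e) j = X (int (Suc k) - 1 - int j)"
      \<comment> \<open>The slots \<open>j < k\<close> are the times \<open>k - j \<ge> 1\<close>,
        covered by the induction hypothesis; the others lie at or before time 0.\<close>
      proof (cases "j < k")
        case True
        then have "state k e (k - j) = X (int (k - j))"
          by (intro Suc.IH) auto
        then show ?thesis using True by (simp add: history_def of_nat_diff)
      next
        case False
        then show ?thesis using X_past by (simp add: history_def)
      qed
    qed
    then show ?thesis
      using X_rec[of "Suc k"] True by (simp add: step_def)
  next
    case False
    then show ?thesis using Suc by (simp add: step_def)
  qed
qed

section \<open>Exponential moments of the deviation\<close>

text \<open>The exponent of \<open>exp_moment_centered_Lipschitz\<close> with
  \<open>c = diag_coeff a (n - k)\<close> and \<open>C = Kc k\<close>.\<close>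

definition exponent :: "real \<Rightarrow> nat \<Rightarrow> real" where
  "exponent t k = 2 / (exp 1)\<^sup>2 * (t * diag_coeff a (n - k) / t0)\<^sup>2
    / (1 - t * diag_coeff a (n - k) / t0) * Kc k"

text \<open>Integrating the newest noise with the state frozen costs a factor that does not depend
  on the state, so it leaves the outer integral. With \<open>nn_integral\<close> no integrability of
  the exponentials has to be known beforehand.\<close>

lemma exp_moment_cmean_state:
  assumes "k \<le> n" and t: "0 \<le> t" "\<And>k. k \<in> {1..n} \<Longrightarrow> t * diag_coeff a (n - k) / t0 < 1"
  shows "(\<integral>\<^sup>+\<omega>. ennreal (exp (t * (cmean (n - k) (state k (\<lambda>i. \<epsilon> i \<omega>)) - cmean n (\<lambda>_. past 0)))) \<partial>M)
    \<le> ennreal (exp (\<Sum>i=1..k. exponent t i))"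
  using assms(1)
proof (induction k)
  case 0
  then show ?case by (simp add: emeasure_space_1)
next
  case (Suc k)
  then have k: "k < n" "Suc k \<in> {1..n}" by auto
  define b where "b = cmean n (\<lambda>_. past 0)"
  define V where "V = (\<lambda>\<omega>. state k (\<lambda>i. \<epsilon> i \<omega>))"
  define \<phi> where "\<phi> = (\<lambda>(u, y). cmean (n - Suc k) (step (Suc k) u y))"
  have joint: "distr M N V \<Otimes>\<^sub>M distr M borel (\<epsilon> (Suc k))
      = distr M (N \<Otimes>\<^sub>M borel) (\<lambda>\<omega>. (V \<omega>, \<epsilon> (Suc k) \<omega>))"
    unfolding V_def by (rule law_state_noise)
  have V_meas [measurable]: "V \<in> M \<rightarrow>\<^sub>M N" and \<epsilon>_meas [measurable]: "\<epsilon> (Suc k) \<in> M \<rightarrow>\<^sub>M borel"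
    unfolding V_def by (rule measurable_state_noise) (rule measurable_noise, simp)
  have \<phi>_meas [measurable]: "\<phi> \<in> borel_measurable (N \<Otimes>\<^sub>M borel)" and [measurable]: "cmean (n - k) \<in> borel_measurable N"
    unfolding \<phi>_def by (rule measurable_cmean_step[OF k(1)]) (simp add: measurable_cmean)
  have \<phi>u_meas: "(\<lambda>y. \<phi> (u, y)) \<in> borel_measurable borel" for u
    unfolding \<phi>_def using measurable_cmean_step_section[OF k(1)] by simp
  have eq: "cmean (n - Suc k) (state (Suc k) (\<lambda>i. \<epsilon> i \<omega>)) = \<phi> (V \<omega>, \<epsilon> (Suc k) \<omega>)" for \<omega>
    by (simp add: \<phi>_def V_def)
  have cmean_u: "cmean (n - k) u = (\<integral>y. \<phi> (u, y) \<partial>law (Suc k))" for u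
    unfolding \<phi>_def by (simp add: cmean_eq[OF k(1)])
  have inner: "(\<integral>\<^sup>+y. ennreal (exp (t * (\<phi> (u, y) - b))) \<partial>law (Suc k))
      \<le> ennreal (exp (exponent t (Suc k))) * ennreal (exp (t * (cmean (n - k) u - b)))" for u
  proof -
    have "(\<integral>\<^sup>+y. ennreal (exp (t * (\<phi> (u, y) - b))) \<partial>law (Suc k))
        = (\<integral>\<^sup>+y. ennreal (exp (t * (\<phi> (u, y) - cmean (n - k) u))) * ennreal (exp (t * (cmean (n - k) u - b))) \<partial>law (Suc k))"
    proof (rule nn_integral_cong)
      fix y
      have "t * (\<phi> (u, y) - b) = t * (\<phi> (u, y) - cmean (n - k) u) + t * (cmean (n - k) u - b)"
        by (simp add: algebra_simps)
      then show "ennreal (exp (t * (\<phi> (u, y) - b)))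
          = ennreal (exp (t * (\<phi> (u, y) - cmean (n - k) u))) * ennreal (exp (t * (cmean (n - k) u - b)))"
        by (simp add: exp_add ennreal_mult')
    qed
    also have "\<dots> = (\<integral>\<^sup>+y. ennreal (exp (t * (\<phi> (u, y) - cmean (n - k) u))) \<partial>law (Suc k))
        * ennreal (exp (t * (cmean (n - k) u - b)))"
      by (rule nn_integral_multc) (use \<phi>u_meas in measurable)
    also have "(\<integral>\<^sup>+y. ennreal (exp (t * (\<phi> (u, y) - cmean (n - k) u))) \<partial>law (Suc k))
        \<le> ennreal (exp (exponent t (Suc k)))"
      unfolding cmean_u exponent_def
    proof (rule exp_moment_centered_Lipschitz[OF prob_space_law sets_law _ _ t0 _ moment_law[OF k(2)]])
      show "\<bar>\<phi> (u, y) - \<phi> (u, y')\<bar> \<le> diag_coeff a (n - Suc k) * dist y y'" for y y'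
        unfolding \<phi>_def using cmean_step_Lipschitz[OF k(1)] by simp
      show "t * diag_coeff a (n - Suc k) / t0 < 1" by (rule t(2)[OF k(2)])
      show "0 \<le> Kc (Suc k)" using Kc[OF k(2)] by simp
    qed (use t(1) diag_coeff_nonneg \<phi>u_meas in auto)
    finally show ?thesis by (simp add: mult_right_mono)
  qed
  have "(\<integral>\<^sup>+\<omega>. ennreal (exp (t * (\<phi> (V \<omega>, \<epsilon> (Suc k) \<omega>) - b))) \<partial>M)
      = (\<integral>\<^sup>+\<omega>. (\<integral>\<^sup>+y. ennreal (exp (t * (\<phi> (V \<omega>, y) - b))) \<partial>law (Suc k)) \<partial>M)"
    unfolding law_def
    by (rule nn_integral_product_law[OF V_meas \<epsilon>_meas joint, of "\<lambda>z. ennreal (exp (t * (\<phi> z - b)))"])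
      (use \<phi>_meas in measurable)
  also have "\<dots> \<le> (\<integral>\<^sup>+\<omega>. ennreal (exp (exponent t (Suc k))) * ennreal (exp (t * (cmean (n - k) (V \<omega>) - b))) \<partial>M)"
    by (intro nn_integral_mono inner)
  also have "\<dots> = ennreal (exp (exponent t (Suc k))) * (\<integral>\<^sup>+\<omega>. ennreal (exp (t * (cmean (n - k) (V \<omega>) - b))) \<partial>M)"
    by (rule nn_integral_cmult) measurable
  also have "\<dots> \<le> ennreal (exp (exponent t (Suc k))) * ennreal (exp (\<Sum>i=1..k. exponent t i))"
    using Suc unfolding V_def b_def by (intro mult_left_mono) auto
  also have "\<dots> = ennreal (exp (\<Sum>i=1..Suc k. exponent t i))"
    by (simp add: ennreal_mult'[symmetric] exp_add[symmetric] add.commute)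
  finally show ?case
    unfolding eq b_def .
qed

text \<open>By monotonicity of \<open>diag_coeff\<close>, every denominator is at least
  \<open>1 - t / \<delta>\<close>; the numerators keep their own coefficients, and \<open>K\<close>
  collects their squared ratios.\<close>

lemma sum_exponent_le:
  assumes "0 \<le> t" "t < t0 / diag_coeff a (n - 1)"
    and K: "K = 2 / (exp 1)\<^sup>2 * (\<Sum>k=1..n. (diag_coeff a (n - k) / diag_coeff a (n - 1))\<^sup>2 * Kc k)"
    and \<delta>: "\<delta> = t0 / diag_coeff a (n - 1)"
  shows "(\<Sum>k=1..n. exponent t k) \<le> (t\<^sup>2 * K / \<delta>\<^sup>2) / (1 - t / \<delta>)"
    and "k \<in> {1..n} \<Longrightarrow> t * diag_coeff a (n - k) / t0 < 1"
proof -
  define A where "A k = diag_coeff a (n - k)" for k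
  have A1: "A 1 > 0" unfolding A_def by (rule less_le_trans[OF zero_less_one diag_coeff_ge_1]) (rule a_nonneg)
  have A0: "A k \<ge> 0" for k unfolding A_def by (rule diag_coeff_nonneg)
  have le: "t * A k / t0 \<le> t / \<delta>" if "k \<in> {1..n}" for k
  proof -
    have "A k \<le> A 1"
      unfolding A_def using that a_nonneg by (intro monoD[OF diag_coeff_mono]) auto
    then show ?thesis
      using assms(1) t0 A1 by (simp add: \<delta> flip: A_def) (simp add: A_def divide_right_mono mult_left_mono)
  qed
  have lt: "t / \<delta> < 1" using assms A1 t0 by (simp add: \<delta> A_def field_simps)
  show "t * diag_coeff a (n - k) / t0 < 1" if "k \<in> {1..n}" for k
    using le[OF that] lt by (simp add: A_def)
  have "(\<Sum>k=1..n. exponent t k)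
      \<le> (\<Sum>k=1..n. 2 / (exp 1)\<^sup>2 * (t * A k / t0)\<^sup>2 / (1 - t / \<delta>) * Kc k)"
  proof (rule sum_mono)
    fix k assume k: "k \<in> {1..n}"
    show "exponent t k \<le> 2 / (exp 1)\<^sup>2 * (t * A k / t0)\<^sup>2 / (1 - t / \<delta>) * Kc k"
      unfolding exponent_def A_def[symmetric] using le[OF k] lt Kc[OF k]
      by (intro mult_right_mono divide_left_mono mult_pos_pos) auto
  qed
  also have "\<dots> = (\<Sum>k=1..n. (t\<^sup>2 / \<delta>\<^sup>2 / (1 - t / \<delta>) * (2 / (exp 1)\<^sup>2)) * ((A k / A 1)\<^sup>2 * Kc k))"
  proof (rule sum.cong[OF refl])
    fix k
    have "t * A k / t0 = (t / \<delta>) * (A k / A 1)"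
      using A1 t0 by (simp add: \<delta> A_def)
    then have "(t * A k / t0)\<^sup>2 = t\<^sup>2 / \<delta>\<^sup>2 * (A k / A 1)\<^sup>2"
      by (simp only: power_mult_distrib power_divide)
    then show "2 / (exp 1)\<^sup>2 * (t * A k / t0)\<^sup>2 / (1 - t / \<delta>) * Kc k
        = (t\<^sup>2 / \<delta>\<^sup>2 / (1 - t / \<delta>) * (2 / (exp 1)\<^sup>2)) * ((A k / A 1)\<^sup>2 * Kc k)"
      by (simp only: times_divide_eq_left times_divide_eq_right mult_ac)
  qed
  also have "\<dots> = (t\<^sup>2 * K / \<delta>\<^sup>2) / (1 - t / \<delta>)"
    unfolding K A_def[symmetric] sum_distrib_left[symmetric] by (simp add: mult_ac)
  finally show "(\<Sum>k=1..n. exponent t k) \<le> (t\<^sup>2 * K / \<delta>\<^sup>2) / (1 - t / \<delta>)" .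
qed

lemma exp_moment_deviation:
  assumes t: "0 \<le> t" "t < \<delta>"
    and K: "K = 2 / (exp 1)\<^sup>2 * (\<Sum>k=1..n. (diag_coeff a (n - k) / diag_coeff a (n - 1))\<^sup>2 * Kc k)"
    and \<delta>: "\<delta> = t0 / diag_coeff a (n - 1)"
  defines "Z \<equiv> (\<lambda>\<omega>. f (state n (\<lambda>i. \<epsilon> i \<omega>)))"
  shows "(\<integral>\<^sup>+\<omega>. ennreal (exp (t * (Z \<omega> - expectation Z))) \<partial>M)
    \<le> ennreal (exp ((t\<^sup>2 * K / \<delta>\<^sup>2) / (1 - t / \<delta>)))"
proof -
  have t': "t < t0 / diag_coeff a (n - 1)" using t \<delta> by simp
  have "expectation Z = cmean n (\<lambda>_. past 0)"
    using cmean_state_integrable_mean[of n] by (simp add: Z_def)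
  then have "(\<integral>\<^sup>+\<omega>. ennreal (exp (t * (Z \<omega> - expectation Z))) \<partial>M)
      \<le> ennreal (exp (\<Sum>k=1..n. exponent t k))"
    using exp_moment_cmean_state[of n t] t(1) sum_exponent_le(2)[OF t(1) t' K \<delta>] by (simp add: Z_def)
  also have "\<dots> \<le> ennreal (exp ((t\<^sup>2 * K / \<delta>\<^sup>2) / (1 - t / \<delta>)))"
    using sum_exponent_le(1)[OF t(1) t' K \<delta>] by (intro ennreal_leI) simp
  finally show ?thesis .
qed

end

section \<open>Tail bound and conclusion\<close>

lemma (in prob_space) bernstein_tail:
  fixes S :: "'a \<Rightarrow> real"
  assumes [measurable]: "S \<in> borel_measurable M"
    and mgf: "\<And>t. 0 \<le> t \<Longrightarrow> t < \<delta> \<Longrightarrow>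
      (\<integral>\<^sup>+\<omega>. ennreal (exp (t * S \<omega>)) \<partial>M) \<le> ennreal (exp ((t\<^sup>2 * K / \<delta>\<^sup>2) / (1 - t / \<delta>)))"
    and pos: "K > 0" "\<delta> > 0" "x > 0"
  shows "prob {\<omega> \<in> space M. S \<omega> \<ge> x}
    \<le> exp (- ((x * \<delta>)\<^sup>2) / (2 * K * (1 + sqrt (1 + x * \<delta> / K)) + x * \<delta>))"
proof -
  define q where "q = sqrt (1 + x * \<delta> / K)"
  define s where "s = 1 - 1 / q"
  \<comment> \<open>The minimiser of \<open>bernstein_exponent\<close> in units of
    \<open>\<delta>\<close>; \<open>s < 1\<close> keeps \<open>t\<close> in the range of
    \<open>mgf\<close>.\<close>
  define t where "t = s * \<delta>"
  have "x * \<delta> > 0" using pos by simp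
  note B = bernstein_exponent[OF this pos(1), folded q_def, folded s_def]
  have s: "0 \<le> s" "s < 1" using B by auto
  have t: "0 \<le> t" "t < \<delta>" using s pos by (auto simp: t_def)
  have "emeasure M {\<omega> \<in> space M. S \<omega> \<ge> x}
      \<le> emeasure M {\<omega> \<in> space M. 1 \<le> ennreal (exp (- t * x)) * ennreal (exp (t * S \<omega>))}"
    using t by (intro emeasure_mono)
      (auto simp: ennreal_mult'[symmetric] exp_add[symmetric] mult_left_mono simp flip: ennreal_1)
  also have "\<dots> \<le> ennreal (exp (- t * x)) * (\<integral>\<^sup>+\<omega>. ennreal (exp (t * S \<omega>)) * indicator (space M) \<omega> \<partial>M)"
    by (rule nn_integral_Markov_inequality[where A = "space M" and u = "\<lambda>\<omega>. ennreal (exp (t * S \<omega>))"]) auto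
  also have "\<dots> = ennreal (exp (- t * x)) * (\<integral>\<^sup>+\<omega>. ennreal (exp (t * S \<omega>)) \<partial>M)"
    by (intro arg_cong2[where f = "(*)"] nn_integral_cong refl) simp
  also have "\<dots> \<le> ennreal (exp (- t * x)) * ennreal (exp ((t\<^sup>2 * K / \<delta>\<^sup>2) / (1 - t / \<delta>)))"
    by (intro mult_left_mono mgf t) simp
  also have "\<dots> = ennreal (exp (- (s * (x * \<delta>) - s\<^sup>2 * K / (1 - s))))"
    using pos by (simp add: ennreal_mult'[symmetric] exp_add[symmetric] t_def power_mult_distrib algebra_simps)
  also have "s * (x * \<delta>) - s\<^sup>2 * K / (1 - s) = (x * \<delta>)\<^sup>2 / (2 * K * (1 + q) + x * \<delta>)"
    using B(1) by (simp add: s_def)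
  finally show ?thesis
    by (simp add: emeasure_eq_measure q_def)
qed

theorem proposition4p3:
  fixes M :: "'w measure"
    and \<epsilon> :: "nat \<Rightarrow> 'w \<Rightarrow> 'y::polish_space"
    and past :: "int \<Rightarrow> 'x::polish_space"
    and F :: "nat \<Rightarrow> (nat \<Rightarrow> 'x) \<times> 'y \<Rightarrow> 'x"
    and X :: "int \<Rightarrow> 'w \<Rightarrow> 'x"
    and a :: "nat \<Rightarrow> real"
    and n :: nat
    and f :: "(nat \<Rightarrow> 'x) \<Rightarrow> real"
    and S :: "'w \<Rightarrow> real"
    and t0 :: real
    and Kc :: "nat \<Rightarrow> real"
    and K \<delta> :: real
  assumes prob: "prob_space M"
    and indep: "prob_space.indep_vars M (\<lambda>_. borel) \<epsilon> {1..}"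
    and F_measurable:
      "\<And>m. m \<ge> 1 \<Longrightarrow> F m \<in> (PiM UNIV (\<lambda>_::nat. borel) \<Otimes>\<^sub>M borel) \<rightarrow>\<^sub>M borel"
    and X_past: "\<And>i \<omega>. i \<le> 0 \<Longrightarrow> \<omega> \<in> space M \<Longrightarrow> X i \<omega> = past i"
    and X_rec:
      "\<And>m \<omega>. m \<ge> 1 \<Longrightarrow> \<omega> \<in> space M \<Longrightarrow>
         X (int m) \<omega> = F m (\<lambda>j. X (int m - 1 - int j) \<omega>, \<epsilon> m \<omega>)"
    and a_nonneg: "\<And>i. i \<ge> 1 \<Longrightarrow> 0 \<le> a i"
    and a_summable: "summable (\<lambda>j. a (Suc j))"
    and a_sum: "(\<Sum>j. a (Suc j)) < 1"
    and contraction: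
      "\<And>m x x'. m \<ge> 1 \<Longrightarrow>
         (\<integral>\<^sup>+ \<omega>. ennreal (dist (F m (x, \<epsilon> m \<omega>)) (F m (x', \<epsilon> m \<omega>))) \<partial>M)
           \<le> (\<Sum>j. ennreal (a (Suc j) * dist (x j) (x' j)))"
    and n: "n \<ge> 1"
    and f_Lipschitz: "\<And>x x'. \<bar>f x - f x'\<bar> \<le> (\<Sum>i = 1..n. dist (x i) (x' i))"
    and S_eq:
      "S = (\<lambda>\<omega>. f (\<lambda>i. X (int i) \<omega>) - prob_space.expectation M (\<lambda>\<omega>'. f (\<lambda>i. X (int i) \<omega>')))"
    and F_Lipschitz:
      "\<And>m x y y'. m \<ge> 1 \<Longrightarrow> dist (F m (x, y)) (F m (x, y')) \<le> dist y y'"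
    and t0: "t0 > 0"
    and Kc: "\<And>k. k \<in> {1..n} \<Longrightarrow> Kc k \<ge> 1"
    and exp_moment:
      "\<And>k. k \<in> {1..n} \<Longrightarrow>
         (\<integral>\<^sup>+ \<omega>. exp_ennreal (ennreal t0 * mean_dist (distr M borel (\<epsilon> k)) (\<epsilon> k \<omega>)) \<partial>M)
           \<le> ennreal (Kc k)"
    and K_eq:
      "K = 2 / (exp 1)\<^sup>2 *
         (\<Sum>k = 1..n. (diag_coeff a (n - k) / diag_coeff a (n - 1))\<^sup>2 * Kc k)"
    and \<delta>_eq: "\<delta> = t0 / diag_coeff a (n - 1)"
  shows "(\<forall>\<sigma>\<in>{1, -1::real}. \<forall>t. 0 \<le> t \<and> t < \<delta> \<longrightarrow>
            (\<integral>\<^sup>+ \<omega>. ennreal (exp (\<sigma> * t * S \<omega>)) \<partial>M)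
              \<le> ennreal (exp ((t\<^sup>2 * K / \<delta>\<^sup>2) / (1 - t / \<delta>))))
       \<and> (\<forall>\<sigma>\<in>{1, -1::real}. \<forall>x>0.
            prob_space.prob M {\<omega> \<in> space M. \<sigma> * S \<omega> \<ge> x}
              \<le> exp (- ((x * \<delta>)\<^sup>2) / (2 * K * (1 + sqrt (1 + x * \<delta> / K)) + x * \<delta>))
          \<and> exp (- ((x * \<delta>)\<^sup>2) / (2 * K * (1 + sqrt (1 + x * \<delta> / K)) + x * \<delta>))
              \<le> exp (- ((x * \<delta>)\<^sup>2) / (4 * K + 2 * x * \<delta>)))"
proof -
  interpret prob_space M by (rule prob)
  have A1: "diag_coeff a k > 0" for k
    by (rule less_le_trans[OF zero_less_one diag_coeff_ge_1]) (rule a_nonneg)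
  have \<delta>_pos: "\<delta> > 0"
    unfolding \<delta>_eq using A1 t0 by simp
  have "(diag_coeff a (n - k) / diag_coeff a (n - 1))\<^sup>2 * Kc k > 0" if "k \<in> {1..n}" for k
    using Kc[OF that] A1[of "n - k"] A1[of "n - 1"] by simp
  \<comment> \<open>The sum is nonempty by \<open>n \<ge> 1\<close>; its positivity matters because
    the tail bound divides by \<open>K\<close>.\<close>
  then have "(\<Sum>k = 1..n. (diag_coeff a (n - k) / diag_coeff a (n - 1))\<^sup>2 * Kc k) > 0"
    using n by (intro sum_pos) auto
  then have K_pos: "K > 0"
    unfolding K_eq by simp
  have S: "(\<lambda>\<omega>. \<sigma> * S \<omega>) \<in> borel_measurable M \<and>
      (\<forall>t. 0 \<le> t \<and> t < \<delta> \<longrightarrow> (\<integral>\<^sup>+ \<omega>. ennreal (exp (t * (\<sigma> * S \<omega>))) \<partial>M)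
        \<le> ennreal (exp ((t\<^sup>2 * K / \<delta>\<^sup>2) / (1 - t / \<delta>))))"
    if \<sigma>: "\<sigma> \<in> {1, -1}" for \<sigma>
  proof -
    have f: "\<bar>\<sigma> * f x - \<sigma> * f x'\<bar> \<le> (\<Sum>i = 1..n. dist (x i) (x' i))" for x x'
      using f_Lipschitz[of x x'] \<sigma> by auto
    \<comment> \<open>The Lipschitz hypothesis survives a change of sign of \<open>f\<close>, so the
      lower tail is an upper tail for \<open>\<sigma> * f\<close>.\<close>
    interpret driven_recursion M \<epsilon> past F a n "\<lambda>x. \<sigma> * f x" t0 Kc
      by unfold_locales
        (fact indep F_measurable a_nonneg contraction f F_Lipschitz t0 Kc exp_moment)+
    define Z where "Z = (\<lambda>\<omega>. \<sigma> * f (state n (\<lambda>i. \<epsilon> i \<omega>)))"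
    \<comment> \<open>The recursion for \<open>X\<close> is given only on \<open>space M\<close>,
      and \<open>state n\<close> matches it only at times \<open>1..n\<close>, the coordinates on
      which \<open>f\<close> depends.\<close>
    have Z_eq: "\<sigma> * f (\<lambda>i. X (int i) \<omega>) = Z \<omega>" if "\<omega> \<in> space M" for \<omega>
      unfolding Z_def
      by (rule f_cong[OF state_eq_recursion[where X = "\<lambda>i. X i \<omega>", symmetric]])
        (use X_past X_rec that in auto)
    have "expectation Z = expectation (\<lambda>\<omega>. \<sigma> * f (\<lambda>i. X (int i) \<omega>))"
      by (intro Bochner_Integration.integral_cong) (simp_all add: Z_eq)
    also have "\<dots> = \<sigma> * expectation (\<lambda>\<omega>. f (\<lambda>i. X (int i) \<omega>))"
      by (rule integral_mult_right_zero)
    finally have SZ: "\<sigma> * S \<omega> = Z \<omega> - expectation Z" if "\<omega> \<in> space M" for \<omega>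
      using Z_eq[OF that] by (simp add: S_eq right_diff_distrib)
    have "integrable M Z"
      using cmean_state_integrable_mean[of n] by (simp add: Z_def)
    then have "(\<lambda>\<omega>. Z \<omega> - expectation Z) \<in> borel_measurable M"
      by simp
    then have meas: "(\<lambda>\<omega>. \<sigma> * S \<omega>) \<in> borel_measurable M"
      by (subst measurable_cong[OF SZ])
    have "(\<integral>\<^sup>+ \<omega>. ennreal (exp (t * (\<sigma> * S \<omega>))) \<partial>M)
        \<le> ennreal (exp ((t\<^sup>2 * K / \<delta>\<^sup>2) / (1 - t / \<delta>)))" if "0 \<le> t" "t < \<delta>" for t
    proof -
      have "(\<integral>\<^sup>+ \<omega>. ennreal (exp (t * (\<sigma> * S \<omega>))) \<partial>M)
          = (\<integral>\<^sup>+ \<omega>. ennreal (exp (t * (Z \<omega> - expectation Z))) \<partial>M)"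
        by (intro nn_integral_cong) (simp add: SZ)
      then show ?thesis
        using exp_moment_deviation[OF that K_eq \<delta>_eq] by (simp add: Z_def)
    qed
    with meas show ?thesis by blast
  qed
  show ?thesis
  proof (intro conjI ballI allI impI)
    fix \<sigma> t :: real assume "\<sigma> \<in> {1, -1}" "0 \<le> t \<and> t < \<delta>"
    then show "(\<integral>\<^sup>+ \<omega>. ennreal (exp (\<sigma> * t * S \<omega>)) \<partial>M)
        \<le> ennreal (exp ((t\<^sup>2 * K / \<delta>\<^sup>2) / (1 - t / \<delta>)))"
      using S[of \<sigma>] by (simp only: mult.assoc mult.left_commute[of \<sigma> t])
  next
    fix \<sigma> x :: real assume "\<sigma> \<in> {1, -1}" "x > 0"
    then show "prob {\<omega> \<in> space M. \<sigma> * S \<omega> \<ge> x}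
        \<le> exp (- ((x * \<delta>)\<^sup>2) / (2 * K * (1 + sqrt (1 + x * \<delta> / K)) + x * \<delta>))"
      using S[of \<sigma>] K_pos \<delta>_pos by (intro bernstein_tail) auto
  next
    fix \<sigma> x :: real assume "x > 0"
    then have "x * \<delta> > 0"
      using \<delta>_pos by simp
    from bernstein_exponent(2)[OF this K_pos]
    show "exp (- ((x * \<delta>)\<^sup>2) / (2 * K * (1 + sqrt (1 + x * \<delta> / K)) + x * \<delta>))
        \<le> exp (- ((x * \<delta>)\<^sup>2) / (4 * K + 2 * x * \<delta>))"
      by (simp add: mult.assoc)
  qed
qed

end
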